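(* Let $n\in\mathbb{N}^+$, $\varepsilon>0$ and $r_\nu=\varepsilon2^{-\nu}$ for $\nu\in\mathbb{N}$. Let $\varphi:[0,\infty)\to[0,\infty)$ be nondecreasing and continuous with $\varphi(0)=0$, and suppose there is $k_*\in\mathbb{N}$ with \[ \int_0^1\frac{\varphi(x)}{x^{k_*+1}}\,\mathrm{d}x<+\infty,\qquad\int_0^1\frac{\varphi(x)}{x^{k_*+2}}\,\mathrm{d}x=+\infty. \] Let $f_\nu$, $\nu\in\mathbb{N}$, be real analytic functions (real on $\mathbb{R}^n$) defined on the strips $\{x\in\mathbb{C}^n:|\operatorname{Im}x|\le r_\nu\}$ with $f_0=0$ and $|f_\nu(x)-f_{\nu-1}(x)|\le\varphi(r_\nu)$ on $|\operatorname{Im}x|\le r_\nu$ for all $\nu\ge1$, and let $f:\mathbb{R}^n\to\mathbb{R}$ be their limit. Then there is a modulus of continuity $\varpi_*$ with $f\in C_{k_*,\varpi_*}(\mathbb{R}^n)$. In particular, $\varpi_*$ can be taken as \[ \varpi_*(\gamma)\sim\gamma\int_{L(\gamma)}^{\varepsilon}\frac{\varphi(t)}{t^{k_*+2}}\,\mathrm{d}t=\mathcal{O}^\#\Big(\int_0^{L(\gamma)}\frac{\varphi(t)}{t^{k_*+1}}\,\mathrm{d}t\Big),\qquad\gamma\to0^+, \] where $L(\gamma)\to0^+$ is some function for which the second relation holds.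
   Context: $|\cdot|$ is the sup-norm. A modulus of continuity is a nondecreasing continuous positive function $\varpi$ on $(0,\delta]$ with $\varpi(0^+)=0$ and $\limsup x/\varpi(x)<\infty$. $[g]_\varpi=\sup_{0<|x-y|\le\delta}|g(x)-g(y)|/\varpi(|x-y|)$, and $C_{k,\varpi}(\mathbb{R}^n)$ is the set of $g$ with partial derivatives up to order $k$ and $\sum_{|\alpha|\le k}(\sup|\partial^\alpha g|+[\partial^\alpha g]_\varpi)<\infty$. For positive functions near $0^+$, $f_1=\mathcal{O}^\#(f_2)$ means $\ell_1f_2\le f_1\le\ell_2f_2$ for constants $0<\ell_1\le\ell_2$; $f_1\sim f_2$ means the same. *)

theory Defs
  imports "HOL-Analysis.Analysis"
begin

definition cvec :: "real^'n \<Rightarrow> complex^'n" where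
  "cvec x = (\<chi> i. complex_of_real (x $ i))"

definition im_vec :: "complex^'n \<Rightarrow> real^'n" where
  "im_vec z = (\<chi> i. Im (z $ i))"

definition strip :: "real \<Rightarrow> (complex^'n) set" where
  "strip r = {z. infnorm (im_vec z) \<le> r}"

definition holo_on :: "(complex^'n \<Rightarrow> complex) \<Rightarrow> (complex^'n) set \<Rightarrow> bool" where
  "holo_on F U \<longleftrightarrow> open U \<and>
     (\<forall>z\<in>U. \<exists>D. (F has_derivative D) (at z) \<and> (\<forall>c w. D (c *s w) = c * D w))"

definition analytic_on_set :: "(complex^'n \<Rightarrow> complex) \<Rightarrow> (complex^'n) set \<Rightarrow> bool" where
  "analytic_on_set F S \<longleftrightarrow> (\<exists>U. S \<subseteq> U \<and> holo_on F U)"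

definition modulus_of_continuity :: "(real \<Rightarrow> real) \<Rightarrow> real \<Rightarrow> bool" where
  "modulus_of_continuity w \<delta> \<longleftrightarrow> \<delta> > 0 \<and>
     mono_on {0<..\<delta>} w \<and> continuous_on {0<..\<delta>} w \<and> (\<forall>x\<in>{0<..\<delta>}. w x > 0) \<and>
     (w \<longlongrightarrow> 0) (at_right 0) \<and>
     (\<exists>C. eventually (\<lambda>x. x / w x \<le> C) (at_right 0))"

definition partial :: "'n \<Rightarrow> (real^'n \<Rightarrow> real) \<Rightarrow> real^'n \<Rightarrow> real" where
  "partial i g x = deriv (\<lambda>t. g (x + t *\<^sub>R axis i 1)) 0"

fun iter_partial :: "'n list \<Rightarrow> (real^'n \<Rightarrow> real) \<Rightarrow> real^'n \<Rightarrow> real" where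
  "iter_partial [] g = g"
| "iter_partial (i # is) g = partial i (iter_partial is g)"

fun partials_exist :: "'n list \<Rightarrow> (real^'n \<Rightarrow> real) \<Rightarrow> bool" where
  "partials_exist [] g = True"
| "partials_exist (i # is) g \<longleftrightarrow> partials_exist is g \<and>
     (\<forall>x. (\<lambda>t. iter_partial is g (x + t *\<^sub>R axis i 1)) differentiable (at 0))"

text \<open>C_{k,w}(\<real>^n): all partial derivatives of order \<le> k exist, are bounded and have
  finite w-seminorm [h]_w = sup_{0<|x-y|\<le>delta} |h x - h y| / w |x-y|
  (finiteness of the finite sum is finiteness of each term).\<close>
definition C_kw :: "nat \<Rightarrow> (real \<Rightarrow> real) \<Rightarrow> real \<Rightarrow> (real^'n \<Rightarrow> real) \<Rightarrow> bool" where
  "C_kw k w \<delta> g \<longleftrightarrow> (\<forall>is. length is \<le> k \<longrightarrow>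
      partials_exist is g \<and>
      (\<exists>B. \<forall>x. \<bar>iter_partial is g x\<bar> \<le> B) \<and>
      (\<exists>C. \<forall>x y. 0 < infnorm (x - y) \<and> infnorm (x - y) \<le> \<delta> \<longrightarrow>
           \<bar>iter_partial is g x - iter_partial is g y\<bar> \<le> C * w (infnorm (x - y))))"

text \<open>f1 = O^#(f2) (equivalently f1 \<sim> f2) as x \<rightarrow> 0+.\<close>
definition bigO_sharp :: "(real \<Rightarrow> real) \<Rightarrow> (real \<Rightarrow> real) \<Rightarrow> bool" where
  "bigO_sharp f1 f2 \<longleftrightarrow> (\<exists>l1 l2. 0 < l1 \<and> l1 \<le> l2 \<and>
     eventually (\<lambda>x. l1 * f2 x \<le> f1 x \<and> f1 x \<le> l2 * f2 x) (at_right 0))"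

end

theory Submission
  imports Defs "HOL-Complex_Analysis.Cauchy_Integral_Formula"
begin

text \<open>
  Put \<open>g\<^sub>n = F\<^sub>n\<^sub>+\<^sub>1 - F\<^sub>n\<close> and \<open>r = \<epsilon> / 2\<^sup>n\<^sup>+\<^sup>1\<close>. By Cauchy's inequality the partial derivatives of \<open>g\<^sub>n\<close>
  of order \<open>m\<close> are \<open>O(\<phi>(r) / r^m)\<close> on real points, so up to order \<open>k\<close> their sums converge
  uniformly, and their increments over a distance \<open>\<gamma>\<close> are
  \<open>O(min (\<phi>(r) / r^k) (\<gamma> \<phi>(r) / r^(k+1)))\<close>. By monotonicity of \<open>\<phi>\<close> the sum over \<open>n\<close> of these
  minima is dominated by the integral of \<open>min (\<phi>(t) / t^(k+1)) (\<gamma> \<phi>(t) / t^(k+2))\<close> over \<open>(0, \<epsilon>]\<close>,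
  hence by \<open>A(s) + \<gamma> B(s)\<close> for every \<open>s\<close>, where \<open>A(s)\<close> integrates the first function over \<open>(0, s]\<close> and
  \<open>\<gamma> B(s)\<close> the second one over \<open>[s, \<epsilon>]\<close>. Choosing \<open>s = L(\<gamma>)\<close> such that \<open>A(s) = \<gamma> B(s)\<close> makes both
  relations of the theorem exact equalities.
\<close>

subsection \<open>Cauchy estimates on strips\<close>

definition open_strip :: "real \<Rightarrow> (complex^'n) set" where
  "open_strip r = {z. infnorm (im_vec z) < r}"

text \<open>Separate holomorphy with a uniform bound: it supports one-variable Cauchy estimates and
  is inherited by partial derivatives on narrower strips. For \<open>r \<le> 0\<close> the open
  strip is empty and the property is vacuous.\<close>

definition sep_holo_bounded :: "real \<Rightarrow> real \<Rightarrow> (complex^'n \<Rightarrow> complex) \<Rightarrow> bool" where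
  "sep_holo_bounded r M h \<longleftrightarrow> (\<forall>z\<in>open_strip r. cmod (h z) \<le> M \<and>
     (\<forall>i. (\<lambda>t. h (z + t *s axis i 1)) field_differentiable at 0))"

definition cpartial :: "'n \<Rightarrow> (complex^'n \<Rightarrow> complex) \<Rightarrow> complex^'n \<Rightarrow> complex" where
  "cpartial i h z = deriv (\<lambda>t. h (z + t *s axis i 1)) 0"

lemma open_strip_shift:
  fixes z :: "complex^'n"
  assumes "z \<in> open_strip r" "cmod t \<le> d"
  shows "z + t *s axis i 1 \<in> open_strip (r + d)"
proof -
  have "im_vec (z + t *s axis i 1) = im_vec z + Im t *\<^sub>R axis i 1"
    by (auto simp: im_vec_def vec_eq_iff axis_def)
  moreover have "infnorm (Im t *\<^sub>R (axis i 1 :: real^'n)) \<le> d"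
    using infnorm_le_norm[of "Im t *\<^sub>R (axis i 1 :: real^'n)"] abs_Im_le_cmod[of t] assms(2)
    by simp
  ultimately show ?thesis
    using infnorm_triangle[of "im_vec z" "Im t *\<^sub>R axis i 1"] assms(1)
    by (simp add: open_strip_def)
qed

text \<open>Moving the base point to \<open>z + s *s axis i 1\<close> turns differentiability at 0
  into differentiability at \<open>s\<close>.\<close>

lemma sep_holo_bounded_at:
  assumes "sep_holo_bounded r M h" "z + s *s axis i 1 \<in> open_strip r"
  shows "(\<lambda>t. h (z + t *s axis i 1)) field_differentiable at s"
proof -
  let ?q = "\<lambda>t. h (z + s *s axis i 1 + t *s axis i 1)"
  have "?q field_differentiable at (s - s)"
    using assms by (simp add: sep_holo_bounded_def)
  then have "(?q \<circ> (\<lambda>t. t - s)) field_differentiable at s"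
    using field_differentiable_compose[of "\<lambda>t. t - s" s ?q]
      field_differentiable_diff[OF field_differentiable_ident field_differentiable_const] by blast
  moreover have "?q \<circ> (\<lambda>t. t - s) = (\<lambda>t. h (z + t *s axis i 1))"
    by (simp add: o_def vector_sub_rdistrib)
  ultimately show ?thesis by simp
qed

lemma sep_holo_bounded_slice:
  assumes h: "sep_holo_bounded r M h" and z: "z \<in> open_strip s" and "s + d \<le> r"
  shows "(\<lambda>t. h (z + t *s axis i 1)) holomorphic_on cball 0 d"
    and "\<And>t. cmod t \<le> d \<Longrightarrow> cmod (h (z + t *s axis i 1)) \<le> M"
proof -
  have *: "z + t *s axis i 1 \<in> open_strip r" if "cmod t \<le> d" for t
    using open_strip_shift[OF z that, of i] \<open>s + d \<le> r\<close> by (auto simp: open_strip_def)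
  show "\<And>t. cmod t \<le> d \<Longrightarrow> cmod (h (z + t *s axis i 1)) \<le> M"
    using * h by (auto simp: sep_holo_bounded_def)
  show "(\<lambda>t. h (z + t *s axis i 1)) holomorphic_on cball 0 d"
    using sep_holo_bounded_at[OF h *]
    by (simp add: holomorphic_on_def field_differentiable_at_within)
qed

text \<open>First-order Taylor formula; Cauchy's inequality on discs of radius \<open>d / 2\<close>
  bounds the second derivative by \<open>2 * M / (d / 2)^2\<close>, whence the 8. Only
  \<open>M\<close> and \<open>d\<close> enter, so the estimate is uniform over all slices of a
  strip.\<close>

lemma difference_quotient_bound:
  assumes hol: "f holomorphic_on cball 0 d" and M: "\<And>t. cmod t \<le> d \<Longrightarrow> cmod (f t) \<le> M"
    and d: "0 < d" and t: "t \<noteq> 0" "cmod t \<le> d / 2"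
  shows "cmod ((f t - f 0) / t - deriv f 0) \<le> 8 * M / d\<^sup>2 * cmod t"
proof -
  have hol': "f holomorphic_on ball 0 d"
    using hol by (rule holomorphic_on_subset) auto
  have bd: "cmod ((deriv ^^ 2) f u) \<le> 8 * M / d\<^sup>2" if u: "u \<in> cball 0 (d/2)" for u
  proof -
    have sub: "cball u (d/2) \<subseteq> cball 0 d"
    proof
      fix v assume "v \<in> cball u (d/2)"
      then show "v \<in> cball 0 d"
        using u norm_triangle_sub[of v u] by (auto simp: dist_norm norm_minus_commute)
    qed
    have "cmod ((deriv ^^ 2) f u) \<le> fact 2 * M / (d/2)^2"
    proof (rule Cauchy_inequality)
      show "f holomorphic_on ball u (d/2)"
        using hol by (rule holomorphic_on_subset) (use sub in auto)
      show "continuous_on (cball u (d/2)) f"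
        using holomorphic_on_imp_continuous_on[OF holomorphic_on_subset[OF hol sub]] .
      fix x assume "cmod (u - x) = d / 2"
      then have "x \<in> cball u (d/2)" by (simp add: dist_norm)
      then show "cmod (f x) \<le> M" using sub M by auto
    qed (use d in auto)
    also have "\<dots> = 8 * M / d\<^sup>2" by (simp add: power_divide)
    finally show ?thesis .
  qed
  have "cmod ((deriv ^^ 0) f t - (\<Sum>i\<le>1. (deriv ^^ i) f 0 * (t - 0)^i / fact i))
      \<le> 8 * M / d\<^sup>2 * cmod (t - 0)^(Suc 1) / fact 1"
  proof (rule complex_Taylor[where S = "cball 0 (d/2)"])
    fix i x assume "x \<in> cball (0::complex) (d/2)"
    then have "x \<in> ball 0 d" using d by auto
    then have "((deriv ^^ i) f has_field_derivative (deriv ^^ Suc i) f x) (at x)"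
      using holomorphic_derivI[OF holomorphic_higher_deriv[OF hol' open_ball]] by simp
    then show "((deriv ^^ i) f has_field_derivative (deriv ^^ Suc i) f x) (at x within cball 0 (d/2))"
      by (rule DERIV_subset) auto
  qed (use bd t d in \<open>auto simp: numeral_2_eq_2\<close>)
  then have "cmod (f t - f 0 - deriv f 0 * t) \<le> 8 * M / d\<^sup>2 * cmod t * cmod t"
    by (simp add: diff_diff_eq power2_eq_square)
  moreover have "(f t - f 0) / t - deriv f 0 = (f t - f 0 - deriv f 0 * t) / t"
    using t by (simp add: field_simps)
  ultimately show ?thesis
    using t by (simp add: norm_divide divide_le_eq)
qed

text \<open>Joint continuity is never needed: the difference quotients converge uniformly, so the
  partial derivative is again separately holomorphic.\<close>

lemma sep_holo_bounded_cpartial: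
  fixes h :: "complex^'n \<Rightarrow> complex"
  assumes h: "sep_holo_bounded r M h" and d: "0 < d"
  shows "sep_holo_bounded (r - d) (M / d) (cpartial i h)"
  unfolding sep_holo_bounded_def
proof (intro ballI conjI allI)
  fix z :: "complex^'n" and j assume z: "z \<in> open_strip (r - d)"
  have slice: "(\<lambda>t. h (y + t *s axis i 1)) holomorphic_on cball 0 d"
    "\<And>t. cmod t \<le> d \<Longrightarrow> cmod (h (y + t *s axis i 1)) \<le> M" if "y \<in> open_strip (r - d)" for y
    using sep_holo_bounded_slice[OF h that, where d = d] by auto
  have "cmod ((deriv ^^ 1) (\<lambda>t. h (z + t *s axis i 1)) 0) \<le> fact 1 * M / d ^ 1"
    using slice[OF z] d
    by (intro Cauchy_inequality) 
      (auto intro: holomorphic_on_subset holomorphic_on_imp_continuous_on)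
  then show "cmod (cpartial i h z) \<le> M / d" by (simp add: cpartial_def)
  \<comment> \<open>The room left for moving \<open>z\<close> along axis \<open>j\<close> inside the
    strip of width \<open>r - d\<close>.\<close>
  define e where "e = r - d - infnorm (im_vec z)"
  have e: "e > 0" using z by (simp add: e_def open_strip_def)
  have in_strip: "z + s *s axis j 1 \<in> open_strip (r - d)" if "cmod s < e" for s
  proof -
    obtain e' where "cmod s < e'" "e' < e" using \<open>cmod s < e\<close> dense by blast
    then show ?thesis
      using open_strip_shift[of z "infnorm (im_vec z) + e - e'" s e' j]
      by (auto simp: open_strip_def e_def)
  qed
  \<comment> \<open>Increments in direction \<open>i\<close>: nonzero, tending to 0 and at most
    \<open>d / 2\<close>, as the Taylor estimate requires. The functions \<open>p n\<close> below
    are the resulting difference quotients, viewed as functions of the displacement \<open>s\<close>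
    in direction \<open>j\<close>.\<close>
  define \<tau> :: "nat \<Rightarrow> complex" where "\<tau> n = of_real (d / 2 / Suc n)" for n
  have \<tau>: "\<tau> n \<noteq> 0" "cmod (\<tau> n) \<le> d / 2" for n
    unfolding \<tau>_def norm_of_real of_real_eq_0_iff using d by (auto simp: divide_le_eq field_simps)
  have "\<tau> \<longlonglongrightarrow> of_real 0"
    unfolding \<tau>_def by (intro tendsto_of_real) (rule LIMSEQ_Suc[OF lim_const_over_n])
  then have \<tau>0: "(\<lambda>n. 8 * M / d\<^sup>2 * cmod (\<tau> n)) \<longlonglongrightarrow> 8 * M / d\<^sup>2 * cmod 0"
    by (intro tendsto_intros) simp
  define p where "p n = (\<lambda>s. (h (z + s *s axis j 1 + \<tau> n *s axis i 1) - h (z + s *s axis j 1)) / \<tau> n)"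
    for n
  have "(\<lambda>s. cpartial i h (z + s *s axis j 1)) holomorphic_on ball 0 e"
  proof (rule holomorphic_uniform_sequence)
    fix n
    \<comment> \<open>The increment \<open>\<tau> n\<close> may leave the strip of width
      \<open>r - d\<close>, but not the one of width \<open>r - d / 2\<close>.\<close>
    have "(\<lambda>s. h ((z + \<tau> n *s axis i 1) + s *s axis j 1)) field_differentiable at s" if "cmod s < e" for s
    proof (rule sep_holo_bounded_at[OF h])
      have "z + s *s axis j 1 + \<tau> n *s axis i 1 \<in> open_strip (r - d + d/2)"
        using open_strip_shift[OF in_strip[OF that] \<tau>(2)] .
      then show "z + \<tau> n *s axis i 1 + s *s axis j 1 \<in> open_strip r"
        using d by (simp add: open_strip_def add_ac)
    qed
    moreover have "(\<lambda>s. h (z + s *s axis j 1)) field_differentiable at s" if "cmod s < e" for s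
      using in_strip[OF that] d by (intro sep_holo_bounded_at[OF h]) (auto simp: open_strip_def)
    ultimately have "(\<lambda>s. (h ((z + \<tau> n *s axis i 1) + s *s axis j 1) - h (z + s *s axis j 1)) / \<tau> n)
        field_differentiable at s" if "cmod s < e" for s
      using that \<tau>(1)[of n]
      by (intro field_differentiable_divide field_differentiable_diff field_differentiable_const)
    moreover have "(z + \<tau> n *s axis i 1) + s *s axis j 1 = z + s *s axis j 1 + \<tau> n *s axis i 1" for s
      by simp
    ultimately show "p n holomorphic_on ball 0 e"
      by (simp add: p_def holomorphic_on_def field_differentiable_at_within)
  next
    fix x :: complex assume "x \<in> ball 0 e"
    then obtain \<rho> where \<rho>: "\<rho> > 0" "cball x \<rho> \<subseteq> ball 0 e"
      by (metis open_ball open_contains_cball)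
    have "uniform_limit (ball 0 e) p (\<lambda>s. cpartial i h (z + s *s axis j 1)) sequentially"
    proof (rule uniform_limitI)
      fix \<eta> :: real assume "\<eta> > 0"
      then have "\<forall>\<^sub>F n in sequentially. 8 * M / d\<^sup>2 * cmod (\<tau> n) < \<eta>"
        using order_tendstoD(2)[OF \<tau>0, of \<eta>] by simp
      then show "\<forall>\<^sub>F n in sequentially. \<forall>s\<in>ball 0 e. dist (p n s) (cpartial i h (z + s *s axis j 1)) < \<eta>"
      proof eventually_elim
        case (elim n)
        show ?case
        proof
          fix s :: complex assume "s \<in> ball 0 e"
          then have "z + s *s axis j 1 \<in> open_strip (r - d)" using in_strip by auto
          from difference_quotient_bound[OF slice[OF this] d \<tau>, of n]
          have "dist (p n s) (cpartial i h (z + s *s axis j 1)) \<le> 8 * M / d\<^sup>2 * cmod (\<tau> n)"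
            by (simp add: p_def cpartial_def dist_norm)
          then show "dist (p n s) (cpartial i h (z + s *s axis j 1)) < \<eta>" using elim by simp
        qed
      qed
    qed
    then show "\<exists>\<rho>>0. cball x \<rho> \<subseteq> ball 0 e \<and>
        uniform_limit (cball x \<rho>) p (\<lambda>s. cpartial i h (z + s *s axis j 1)) sequentially"
      using \<rho> uniform_limit_on_subset by blast
  qed simp
  then show "(\<lambda>s. cpartial i h (z + s *s axis j 1)) field_differentiable at 0"
    using e by (meson centre_in_ball holomorphic_on_imp_differentiable_at open_ball)
qed

fun iter_cpartial :: "'n list \<Rightarrow> (complex^'n \<Rightarrow> complex) \<Rightarrow> complex^'n \<Rightarrow> complex" where
  "iter_cpartial [] h = h"
| "iter_cpartial (i # is) h = cpartial i (iter_cpartial is h)"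

lemma sep_holo_bounded_iter_cpartial:
  fixes d :: real
  assumes "sep_holo_bounded r M h" "0 < d"
  shows "sep_holo_bounded (r - length is * d) (M / d ^ length is) (iter_cpartial is h)"
proof (induction "is")
  case Nil
  then show ?case using assms by simp
next
  case (Cons i "is")
  from sep_holo_bounded_cpartial[OF Cons \<open>0 < d\<close>, of i] show ?case
    by (simp add: algebra_simps)
qed

section \<open>Restriction to real points: bounds, derivatives and increments\<close>

lemma cvec_in_open_strip: "0 < r \<Longrightarrow> cvec x \<in> open_strip r"
proof -
  have "im_vec (cvec x) = 0" by (auto simp: im_vec_def cvec_def vec_eq_iff)
  then show "0 < r \<Longrightarrow> cvec x \<in> open_strip r" by (simp add: open_strip_def infnorm_0)
qed

text \<open>Each derivative costs a strip of width \<open>r / (k + 2)\<close>; the factor \<open>1 + e\<close> allows a derivative of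
  lower order to be bounded by \<open>M / r ^ p\<close>.\<close>

lemma Re_iter_cpartial_bound:
  fixes r M e :: real
  assumes h: "sep_holo_bounded r M h" and r: "0 < r" and "0 \<le> M"
    and "length is \<le> p" "p \<le> Suc k" "r \<le> e"
  shows "\<bar>Re (iter_cpartial is h (cvec x))\<bar> \<le> ((real k + 2) * (1 + e)) ^ p * (M / r ^ p)"
proof -
  define d where "d = r / (real k + 2)"
  have d: "d > 0" using r by (simp add: d_def)
  \<comment> \<open>At most \<open>k + 1\<close> derivatives are taken, so a strip of positive width
    survives around the real points.\<close>
  have "length is * d \<le> (k + 1) * d" using assms d by (intro mult_right_mono) auto
  also have "\<dots> < r" using r by (simp add: d_def field_simps)
  finally have "cvec x \<in> open_strip (r - length is * d)" by (intro cvec_in_open_strip) simp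
  then have "cmod (iter_cpartial is h (cvec x)) \<le> M / d ^ length is"
    using sep_holo_bounded_iter_cpartial[OF h d, of "is"] by (auto simp: sep_holo_bounded_def)
  with abs_Re_le_cmod have "\<bar>Re (iter_cpartial is h (cvec x))\<bar> \<le> M / d ^ length is"
    by (rule order_trans)
  also have "\<dots> = M * ((real k + 2) / r) ^ length is" using r by (simp add: d_def power_divide)
  also have "\<dots> \<le> M * ((real k + 2) * (1 + e) / r) ^ length is"
    using assms by (intro mult_left_mono power_mono divide_right_mono) auto
  \<comment> \<open>The base is at least 1 because \<open>r \<le> e\<close>, so the exponent may be
    raised to \<open>p\<close>.\<close>
  also have "\<dots> \<le> M * ((real k + 2) * (1 + e) / r) ^ p"
  proof (intro mult_left_mono power_increasing)
    have "r \<le> 1 * (1 + e)" using assms by simp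
    also have "\<dots> \<le> (real k + 2) * (1 + e)" using assms by (intro mult_right_mono) auto
    finally show "1 \<le> (real k + 2) * (1 + e) / r" using r by simp
  qed (use assms in auto)
  finally show ?thesis by (simp add: power_divide algebra_simps)
qed

text \<open>A complex derivative along an axis is also the derivative for real increments, and real
  parts commute with differentiation in a real variable.\<close>

lemma iter_cpartial_has_real_derivative:
  assumes h: "sep_holo_bounded r M h" and r: "0 < r"
  shows "((\<lambda>t. Re (iter_cpartial is h (cvec (x + t *\<^sub>R axis i 1)))) has_real_derivative
     Re (iter_cpartial (i # is) h (cvec (x + s *\<^sub>R axis i 1)))) (at s)"
proof -
  \<comment> \<open>After \<open>length is\<close> differentiations a strip of width exactly
    \<open>d\<close> remains.\<close>
  define d where "d = r / (length is + 1)"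
  have d: "d > 0" using r by (simp add: d_def)
  have "length is * d < r" using r by (simp add: d_def field_simps)
  then have "cvec (x + s *\<^sub>R axis i 1) \<in> open_strip (r - length is * d)"
    by (intro cvec_in_open_strip) simp
  then have "(\<lambda>t. iter_cpartial is h (cvec (x + s *\<^sub>R axis i 1) + t *s axis i 1)) field_differentiable at 0"
    using sep_holo_bounded_iter_cpartial[OF h d, of "is"] by (auto simp: sep_holo_bounded_def)
  then have "((\<lambda>t. iter_cpartial is h (cvec (x + s *\<^sub>R axis i 1) + t *s axis i 1))
      has_field_derivative iter_cpartial (i # is) h (cvec (x + s *\<^sub>R axis i 1))) (at (complex_of_real (s - s)))"
    by (simp add: cpartial_def field_differentiable_derivI)
  moreover have shift: "((\<lambda>t. complex_of_real (t - s)) has_vector_derivative 1) (at s)"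
    by (auto intro!: derivative_eq_intros simp: has_vector_derivative_def scaleR_conv_of_real)
  ultimately have "((\<lambda>t. iter_cpartial is h (cvec (x + s *\<^sub>R axis i 1) + of_real (t - s) *s axis i 1))
      has_vector_derivative iter_cpartial (i # is) h (cvec (x + s *\<^sub>R axis i 1))) (at s)"
    using field_vector_diff_chain_at[of "\<lambda>t. complex_of_real (t - s)" 1 s
      "\<lambda>t. iter_cpartial is h (cvec (x + s *\<^sub>R axis i 1) + t *s axis i 1)"] shift
    by (simp add: o_def)
  from has_field_derivative_Re[OF this]
  have "((\<lambda>t. Re (iter_cpartial is h (cvec (x + s *\<^sub>R axis i 1) + of_real (t - s) *s axis i 1)))
      has_real_derivative Re (iter_cpartial (i # is) h (cvec (x + s *\<^sub>R axis i 1)))) (at s)" .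
  moreover have "cvec (x + s *\<^sub>R axis i 1) + of_real (t - s) *s axis i 1 = cvec (x + t *\<^sub>R axis i 1)" for t
    by (auto simp: cvec_def vec_eq_iff axis_def algebra_simps)
  ultimately show ?thesis by simp
qed

text \<open>Complex linearity of the total derivative \<open>D\<close> gives
  \<open>D (t *s axis i 1) = t * D (axis i 1)\<close>, which is a complex derivative in
  \<open>t\<close>.\<close>

lemma holo_on_imp_field_differentiable_axis:
  fixes F :: "complex^'n \<Rightarrow> complex"
  assumes "holo_on F U" "z \<in> U"
  shows "(\<lambda>t. F (z + t *s axis i 1)) field_differentiable at 0"
proof -
  obtain D where D: "(F has_derivative D) (at z)" "\<And>c w. D (c *s w) = c * D w"
    using assms by (auto simp: holo_on_def)
  have "((\<lambda>t. z + t *s axis i 1) has_derivative (\<lambda>t::complex. t *s (axis i 1 :: complex^'n))) (at 0)"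
  proof -
    have "linear (\<lambda>t::complex. t *s (axis i 1 :: complex^'n))"
      by (intro linearI) (simp_all add: vec_eq_iff distrib_right)
    then have "bounded_linear (\<lambda>t::complex. t *s (axis i 1 :: complex^'n))"
      by (rule linear_conv_bounded_linear[THEN iffD1])
    then show ?thesis
      by (intro has_derivative_add_const[where f = "\<lambda>t. t *s axis i 1", simplified add.commute]
          bounded_linear_imp_has_derivative)
  qed
  from has_derivative_compose[OF this, of F D] D
  have "((\<lambda>t. F (z + t *s axis i 1)) has_derivative (\<lambda>t. D (axis i 1) * t)) (at 0)"
    by (simp add: mult.commute)
  then show ?thesis
    unfolding field_differentiable_def has_field_derivative_def by blast
qed

text \<open>Pass from \<open>y\<close> to \<open>x\<close> by changing one coordinate at a time; by
  the mean value estimate each of the \<open>CARD('n)\<close> moves costs at most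
  \<open>M * infnorm (x - y)\<close>.\<close>

lemma coordinatewise_lipschitz:
  fixes g :: "real^'n \<Rightarrow> real" and M :: real
  assumes der: "\<And>x i s. ((\<lambda>t. g (x + t *\<^sub>R axis i 1)) has_real_derivative g' i (x + s *\<^sub>R axis i 1)) (at s)"
    and bd: "\<And>x i. \<bar>g' i x\<bar> \<le> M"
  shows "\<bar>g x - g y\<bar> \<le> CARD('n) * M * infnorm (x - y)"
proof -
  define mix where "mix S = (\<chi> i. if i \<in> S then x $ i else y $ i)" for S
  have M: "0 \<le> M" using bd order_trans abs_ge_zero by blast
  have "\<bar>g (mix S) - g y\<bar> \<le> card S * M * infnorm (x - y)" if "finite S" for S
    using that
  proof (induction S)
    case empty
    then show ?case by (simp add: mix_def)
  next
    case (insert j S)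
    have eq: "mix (insert j S) = mix S + (x $ j - y $ j) *\<^sub>R axis j 1"
      using insert by (auto simp: mix_def vec_eq_iff axis_def)
    have "norm (g (mix S + (x $ j - y $ j) *\<^sub>R axis j 1) - g (mix S + 0 *\<^sub>R axis j 1)) \<le> M * norm (x $ j - y $ j - 0)"
      by (rule field_differentiable_bound[where S = UNIV and f = "\<lambda>t. g (mix S + t *\<^sub>R axis j 1)"])
        (auto intro: der bd)
    also have "\<dots> \<le> M * infnorm (x - y)"
      using component_le_infnorm_cart[of "x - y" j] M by (intro mult_left_mono) auto
    finally have "\<bar>g (mix (insert j S)) - g (mix S)\<bar> \<le> M * infnorm (x - y)" by (simp add: eq)
    then show ?case using insert by (simp add: algebra_simps)
  qed
  from this[of UNIV] show ?thesis by (simp add: mix_def)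
qed

subsection \<open>The balancing point and the modulus of continuity\<close>

text \<open>The interval from \<open>e / 2 ^ Suc n\<close> to \<open>e / 2 ^ n\<close> has length
  \<open>e / 2 ^ Suc n\<close>, so \<open>c n\<close> is at most the integral of
  \<open>\<psi>\<close> over it; these intervals tile \<open>{e / 2 ^ N..e}\<close>.\<close>

lemma dyadic_sum_le_integral:
  fixes \<psi> :: "real \<Rightarrow> real"
  assumes e: "0 < e" and int: "\<And>s. 0 < s \<Longrightarrow> \<psi> integrable_on {s..e}"
    and c: "\<And>n t. n < N \<Longrightarrow> e / 2 ^ Suc n \<le> t \<Longrightarrow> t \<le> e / 2 ^ n \<Longrightarrow> c n \<le> e / 2 ^ Suc n * \<psi> t"
  shows "(\<Sum>n<N. c n) \<le> integral {e / 2 ^ N..e} \<psi>"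
  using c
proof (induction N)
  case 0
  then show ?case by simp
next
  case (Suc N)
  let ?s = "e / 2 ^ Suc N" and ?t = "e / 2 ^ N"
  have st: "0 < ?s" "?s \<le> ?t" "?t \<le> e" using e by (auto simp: field_simps)
  have "c N = integral {?s..?t} (\<lambda>t. c N / ?s)"
    using st e by (simp add: field_simps)
  also have "\<dots> \<le> integral {?s..?t} \<psi>"
  proof (rule integral_le)
    show "\<psi> integrable_on {?s..?t}"
      using int[OF st(1)] by (rule integrable_subinterval_real) (use st in auto)
    show "c N / ?s \<le> \<psi> t" if "t \<in> {?s..?t}" for t
    proof -
      have "c N \<le> ?s * \<psi> t" using Suc.prems[of N t] that by simp
      then show ?thesis using st(1) by (simp only: pos_divide_le_eq mult.commute[of "\<psi> t"])
    qed
  qed auto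
  finally have "c N \<le> integral {?s..?t} \<psi>" .
  moreover have "(\<Sum>n<N. c n) \<le> integral {?t..e} \<psi>"
    by (rule Suc.IH) (use Suc.prems in auto)
  moreover have "integral {?s..?t} \<psi> + integral {?t..e} \<psi> = integral {?s..e} \<psi>"
    using st(2,3) int[OF st(1)] by (rule Henstock_Kurzweil_Integration.integral_combine)
  ultimately show ?case by simp
qed

locale weight =
  fixes \<epsilon> :: real and \<phi> :: "real \<Rightarrow> real" and k :: nat
  assumes eps: "\<epsilon> > 0"
    and phi_nonneg: "\<forall>x\<ge>0. \<phi> x \<ge> 0"
    and phi_mono: "mono_on {0..} \<phi>"
    and phi_cont: "continuous_on {0..} \<phi>"
    and int_fin: "(\<lambda>x. \<phi> x / x ^ (k + 1)) integrable_on {0<..1}"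
    and int_inf: "\<not> (\<lambda>x. \<phi> x / x ^ (k + 2)) integrable_on {0<..1}"
begin

section \<open>Head and tail integrals of the weight\<close>

definition A :: "real \<Rightarrow> real" where "A s = integral {0..s} (\<lambda>t. \<phi> t / t ^ (k + 1))"

definition B :: "real \<Rightarrow> real" where "B s = integral {s..\<epsilon>} (\<lambda>t. \<phi> t / t ^ (k + 2))"

lemma quotient_integrable: "0 < s \<Longrightarrow> (\<lambda>x. \<phi> x / x ^ m) integrable_on {s..t}"
  by (intro integrable_continuous_real continuous_intros continuous_on_subset[OF phi_cont]) auto

text \<open>A zero at \<open>t > 0\<close> would by monotonicity make \<open>\<phi>\<close> vanish
  on all of \<open>{0..t}\<close>, contradicting the divergence hypothesis. Positivity of
  \<open>A\<close>, \<open>B\<close> and \<open>w\<close> rests on this.\<close>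

lemma phi_pos:
  assumes "0 < t"
  shows "0 < \<phi> t"
proof (rule ccontr)
  define t0 where "t0 = min t 1"
  assume "\<not> 0 < \<phi> t"
  then have zero: "\<phi> x = 0" if "0 \<le> x" "x \<le> t0" for x
    using that mono_onD[OF phi_mono, of x t] phi_nonneg by (force simp: t0_def)
  have t0: "0 < t0" "t0 \<le> 1" using assms by (auto simp: t0_def)
  have 0: "(\<lambda>x. \<phi> x / x ^ (k + 2)) integrable_on {0..t0}"
    by (rule integrable_eq[OF integrable_0]) (use zero in auto)
  have "(\<lambda>x. \<phi> x / x ^ (k + 2)) integrable_on {0..1}"
    by (rule Henstock_Kurzweil_Integration.integrable_combine[OF _ _ 0 quotient_integrable])
      (use t0 in auto)
  moreover have "{0..1} = insert 0 {0<..1::real}" by auto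
  ultimately show False
    using int_inf integrable_on_insert_iff by metis
qed

lemma A_integrable: "(\<lambda>x. \<phi> x / x ^ (k + 1)) integrable_on {0..s}"
proof -
  have "{0..1} = insert 0 {0<..1::real}" by auto
  then have 1: "(\<lambda>x. \<phi> x / x ^ (k + 1)) integrable_on {0..1}"
    using int_fin integrable_on_insert_iff by metis
  \<comment> \<open>Beyond 1 the integrand is continuous; the maximum treats \<open>s < 1\<close>
    and \<open>s \<ge> 1\<close> together.\<close>
  have "(\<lambda>x. \<phi> x / x ^ (k + 1)) integrable_on {0..max 1 s}"
    by (rule Henstock_Kurzweil_Integration.integrable_combine[OF _ _ 1 quotient_integrable]) auto
  then show ?thesis by (rule integrable_subinterval_real) auto
qed

lemma quotient_nonneg: "0 \<le> t \<Longrightarrow> 0 \<le> \<phi> t / t ^ m"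
  using phi_nonneg by simp

lemma A_mono: "s \<le> t \<Longrightarrow> A s \<le> A t"
  unfolding A_def by (intro integral_subset_le A_integrable) (auto simp: quotient_nonneg simp del: power_Suc)

lemma B_antimono: "0 < s \<Longrightarrow> s \<le> t \<Longrightarrow> B t \<le> B s"
  unfolding B_def by (intro integral_subset_le quotient_integrable) (auto simp: quotient_nonneg simp del: power_Suc)

lemma integral_quotient_pos:
  assumes "0 < s" "s < t"
  shows "0 < integral {s..t} (\<lambda>x. \<phi> x / x ^ m)"
proof -
  have "0 < (t - s) * (\<phi> s / t ^ m)" using assms phi_pos[of s] by simp
  also have "\<dots> = integral {s..t} (\<lambda>x. \<phi> s / t ^ m)" using assms by simp
  also have "\<dots> \<le> integral {s..t} (\<lambda>x. \<phi> x / x ^ m)"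
  proof (intro integral_le quotient_integrable)
    fix x assume x: "x \<in> {s..t}"
    then have "\<phi> s \<le> \<phi> x" using assms by (intro mono_onD[OF phi_mono]) auto
    then show "\<phi> s / t ^ m \<le> \<phi> x / x ^ m"
      using x assms phi_pos[of x] by (intro frac_le power_mono) auto
  qed (use assms in auto)
  finally show ?thesis .
qed

lemma B_pos: "0 < s \<Longrightarrow> s < \<epsilon> \<Longrightarrow> 0 < B s"
  unfolding B_def by (rule integral_quotient_pos)

lemma A_pos: "0 < s \<Longrightarrow> 0 < A s"
proof -
  assume "0 < s"
  then have "0 < integral {s/2..s} (\<lambda>x. \<phi> x / x ^ (k + 1))" by (intro integral_quotient_pos) auto
  also have "\<dots> \<le> A s"
    unfolding A_def using \<open>0 < s\<close>
    by (intro integral_subset_le A_integrable quotient_integrable) (auto simp: quotient_nonneg simp del: power_Suc)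
  finally show ?thesis .
qed

lemma A_continuous: "continuous_on {0..s} A"
  unfolding A_def using A_integrable by (rule indefinite_integral_continuous_1)

lemma A_tendsto_0: "(A \<longlongrightarrow> 0) (at_right 0)"
proof -
  have "A 0 = 0" by (simp add: A_def)
  moreover have "(A \<longlongrightarrow> A 0) (at 0 within {0..1})"
    using A_continuous[of 1] by (auto simp: continuous_on_def)
  ultimately have "(A \<longlongrightarrow> 0) (at 0 within {0..1})" by simp
  then show ?thesis
    by (metis at_within_Icc_at_right zero_less_one)
qed

lemma B_continuous: "0 < s \<Longrightarrow> continuous_on {s..\<epsilon>} B"
  unfolding B_def using quotient_integrable by (rule indefinite_integral_continuous_1')

text \<open>Intermediate value theorem for \<open>A - \<gamma> * B\<close>: near 0 it is
  nonpositive, as \<open>A\<close> tends to 0 while \<open>B\<close> stays above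
  \<open>B (\<epsilon> / 2)\<close>; at \<open>\<epsilon>\<close> it is positive, as
  \<open>B \<epsilon> = 0\<close>.\<close>

lemma balance_point_exists:
  assumes "0 < \<gamma>"
  shows "\<exists>s. 0 < s \<and> s < \<epsilon> \<and> A s = \<gamma> * B s"
proof -
  have "0 < \<gamma> * B (\<epsilon> / 2)" using assms B_pos[of "\<epsilon>/2"] eps by simp
  then have "\<forall>\<^sub>F s in at_right 0. A s < \<gamma> * B (\<epsilon> / 2)"
    using order_tendstoD(2)[OF A_tendsto_0] by simp
  then obtain b where b: "0 < b" "\<And>s. 0 < s \<Longrightarrow> s < b \<Longrightarrow> A s < \<gamma> * B (\<epsilon> / 2)"
    by (auto simp: eventually_at_right_field)
  define s where "s = min (b/2) (\<epsilon>/2)"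
  have s: "0 < s" "s < b" "s \<le> \<epsilon>/2" "s < \<epsilon>" using b eps by (auto simp: s_def)
  have "A s \<le> \<gamma> * B s"
    using b(2)[OF s(1,2)] mult_left_mono[OF B_antimono[OF s(1,3)], of \<gamma>] assms by linarith
  moreover have "0 < A \<epsilon> - \<gamma> * B \<epsilon>" using A_pos[OF eps] by (simp add: B_def)
  moreover have "continuous_on {s..\<epsilon>} (\<lambda>s. A s - \<gamma> * B s)"
    using s by (intro continuous_intros B_continuous continuous_on_subset[OF A_continuous[of \<epsilon>]]) auto
  ultimately obtain x where x: "s \<le> x" "x \<le> \<epsilon>" "A x - \<gamma> * B x = 0"
    using IVT'[of "\<lambda>s. A s - \<gamma> * B s" s 0 \<epsilon>] s by auto
  moreover have "x \<noteq> \<epsilon>" using x \<open>0 < A \<epsilon> - \<gamma> * B \<epsilon>\<close> by auto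
  ultimately show ?thesis using s by (intro exI[of _ x]) auto
qed

text \<open>An arbitrary choice of balance point; monotonicity and the limit at 0 are derived from
  the balance equation alone.\<close>

definition L :: "real \<Rightarrow> real" where
  "L \<gamma> = (SOME s. 0 < s \<and> s < \<epsilon> \<and> A s = \<gamma> * B s)"

lemma L:
  assumes "0 < \<gamma>"
  shows "0 < L \<gamma>" "L \<gamma> < \<epsilon>" "A (L \<gamma>) = \<gamma> * B (L \<gamma>)"
  using someI_ex[OF balance_point_exists[OF assms]] by (auto simp: L_def)

lemma L_mono:
  assumes "0 < \<gamma>" "\<gamma> \<le> \<gamma>'"
  shows "L \<gamma> \<le> L \<gamma>'"
proof (rule ccontr)
  assume less: "\<not> L \<gamma> \<le> L \<gamma>'"
  then have "\<gamma> \<noteq> \<gamma>'" by auto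
  then have "\<gamma> * B (L \<gamma>) < \<gamma>' * B (L \<gamma>)" using assms L B_pos by simp
  also have "\<dots> \<le> \<gamma>' * B (L \<gamma>')"
    using assms less L by (intro mult_left_mono B_antimono) auto
  also have "\<dots> = A (L \<gamma>')" using assms L by simp
  also have "\<dots> \<le> A (L \<gamma>)" using less by (intro A_mono) auto
  finally show False using L assms by simp
qed

lemma L_at_right: "filterlim L (at_right 0) (at_right 0)"
proof -
  have "(L \<longlongrightarrow> 0) (at_right 0)"
  proof (rule order_tendstoI)
    fix a :: real assume "0 < a"
    define s where "s = min a (\<epsilon>/2)"
    have s: "0 < s" "s < \<epsilon>" "s \<le> a" using \<open>0 < a\<close> eps by (auto simp: s_def)
    have "\<forall>\<^sub>F \<gamma> in at_right 0. \<gamma> < A s / B s"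
      using A_pos B_pos s by (intro order_tendstoD(2)[OF tendsto_ident_at]) auto
    moreover have "\<forall>\<^sub>F \<gamma> in at_right 0. (0::real) < \<gamma>"
      by (simp add: eventually_at_right_less)
    ultimately show "\<forall>\<^sub>F \<gamma> in at_right 0. L \<gamma> < a"
    proof eventually_elim
      case (elim \<gamma>)
      show ?case
      proof (rule ccontr)
        assume "\<not> L \<gamma> < a"
        then have "s \<le> L \<gamma>" using s by simp
        then have "A s \<le> \<gamma> * B (L \<gamma>)" using A_mono[of s "L \<gamma>"] L elim by simp
        also have "\<dots> \<le> \<gamma> * B s"
          using s elim \<open>s \<le> L \<gamma>\<close> by (intro mult_left_mono B_antimono) auto
        finally show False using elim B_pos s by (simp add: less_divide_eq)
      qed
    qed
  next
    fix a :: real assume "a < 0"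
    then show "\<forall>\<^sub>F \<gamma> in at_right 0. a < L \<gamma>"
      by (auto intro!: eventually_at_rightI[of 0 1] less_trans[OF _ L(1)])
  qed
  then show ?thesis
    by (auto simp: filterlim_at intro!: eventually_at_rightI[of 0 1] L(1) less_imp_neq[THEN not_sym])
qed

definition w :: "real \<Rightarrow> real" where "w \<gamma> = A (L \<gamma>)"

lemma w_pos: "0 < \<gamma> \<Longrightarrow> 0 < w \<gamma>"
  unfolding w_def by (intro A_pos L)

lemma w_mono: "0 < \<gamma> \<Longrightarrow> \<gamma> \<le> \<gamma>' \<Longrightarrow> w \<gamma> \<le> w \<gamma>'"
  unfolding w_def by (intro A_mono L_mono)

lemma w_over_ident_antimono:
  assumes "0 < \<gamma>" "\<gamma> \<le> \<gamma>'"
  shows "w \<gamma>' / \<gamma>' \<le> w \<gamma> / \<gamma>"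
  using assms B_antimono[OF L(1) L_mono] by (simp add: w_def L)

text \<open>Since \<open>w\<close> is nondecreasing and \<open>w \<gamma> / \<gamma>\<close> is nonincreasing, \<open>w\<close> is locally Lipschitz.\<close>

lemma w_continuous: "continuous_on {0<..1} w"
proof (rule continuous_on_subset)
  have lip: "\<bar>w x - w y\<bar> \<le> w a / a * \<bar>x - y\<bar>" if "0 < a" "a \<le> y" "y \<le> x" for a x y
  proof -
    have "w x - w y \<le> w y / y * (x - y)"
      using w_over_ident_antimono[of y x] that by (simp add: field_simps)
    also have "\<dots> \<le> w a / a * (x - y)"
      using that by (intro mult_right_mono w_over_ident_antimono) auto
    finally show ?thesis using w_mono[of y x] that by simp
  qed
  show "continuous_on {0<..} w"
  proof (rule continuous_at_imp_continuous_on, rule ballI)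
    fix a :: real assume "a \<in> {0<..}"
    then have "0 < a / 2" by simp
    have "(w (a / 2) / (a / 2))-lipschitz_on {a / 2..} w"
    proof (rule lipschitz_onI)
      fix x y assume "x \<in> {a / 2..}" "y \<in> {a / 2..}"
      then show "dist (w x) (w y) \<le> w (a / 2) / (a / 2) * dist x y"
        using lip[OF \<open>0 < a / 2\<close>, of x y] lip[OF \<open>0 < a / 2\<close>, of y x]
        unfolding dist_real_def abs_minus_commute[of "w x"] abs_minus_commute[of x]
        by (cases x y rule: le_cases) (simp_all add: abs_minus_commute)
    qed (use w_pos[OF \<open>0 < a / 2\<close>] \<open>0 < a / 2\<close> in \<open>auto intro: divide_nonneg_pos\<close>)
    then have "continuous_on {a/2..} w" using \<open>0 < a/2\<close> lipschitz_on_continuous_on by blast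
    then show "isCont w a"
      using \<open>0 < a/2\<close> by (intro continuous_on_interior) auto
  qed
qed auto

lemma w_modulus: "modulus_of_continuity w 1"
  unfolding modulus_of_continuity_def
proof (intro conjI)
  show "mono_on {0<..1} w" by (auto intro!: mono_onI w_mono)
  show "(w \<longlongrightarrow> 0) (at_right 0)"
    unfolding w_def using filterlim_compose[OF A_tendsto_0 L_at_right] .
  show "\<exists>C. \<forall>\<^sub>F x in at_right 0. x / w x \<le> C"
  proof (intro exI eventually_at_rightI[of 0 1])
    fix x :: real assume x: "x \<in> {0<..<1}"
    then have "w 1 / 1 \<le> w x / x" by (intro w_over_ident_antimono) auto
    then show "x / w x \<le> 1 / w 1" using x w_pos[of x] w_pos[of 1] by (simp add: field_simps)
  qed simp
qed (auto simp: w_pos w_continuous)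

lemma min_quotient_integral_le:
  assumes "0 < \<gamma>" "0 < s" "s \<le> \<epsilon>"
  shows "integral {s..\<epsilon>} (\<lambda>t. min (\<phi> t / t ^ (k + 1)) (\<gamma> * (\<phi> t / t ^ (k + 2)))) \<le> 2 * w \<gamma>"
    (is "integral _ ?\<psi> \<le> _")
proof -
  define u where "u = max s (L \<gamma>)"
  have u: "s \<le> u" "u \<le> \<epsilon>" "L \<gamma> \<le> u" "0 < u" using L[OF assms(1)] assms by (auto simp: u_def)
  have int: "?\<psi> integrable_on {a..b}" if "0 < a" for a b
    using that by (intro integrable_continuous_real continuous_intros continuous_on_subset[OF phi_cont]) auto
  have "integral {s..u} ?\<psi> \<le> w \<gamma>"
  proof (cases "s \<le> L \<gamma>")
    case True
    have "integral {s..u} ?\<psi> \<le> integral {s..u} (\<lambda>t. \<phi> t / t ^ (k + 1))"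
      using assms by (intro integral_le int quotient_integrable) auto
    also have "\<dots> \<le> integral {0..L \<gamma>} (\<lambda>t. \<phi> t / t ^ (k + 1))"
      using True assms
      by (intro integral_subset_le quotient_integrable A_integrable)
        (auto simp: u_def quotient_nonneg simp del: power_Suc)
    finally show ?thesis by (simp add: w_def A_def)
  next
    case False
    then show ?thesis using w_pos[OF assms(1)] by (simp add: u_def max_def)
  qed
  moreover have "integral {u..\<epsilon>} ?\<psi> \<le> w \<gamma>"
  proof -
    have "integral {u..\<epsilon>} ?\<psi> \<le> integral {u..\<epsilon>} (\<lambda>t. \<gamma> * (\<phi> t / t ^ (k + 2)))"
      using u assms by (intro integral_le int quotient_integrable integrable_on_mult_right) auto
    also have "\<dots> = \<gamma> * B u" unfolding B_def by (rule integral_mult_right)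
    also have "\<dots> \<le> \<gamma> * B (L \<gamma>)" using assms u L by (intro mult_left_mono B_antimono) auto
    finally show ?thesis using L assms by (simp add: w_def)
  qed
  moreover have "integral {s..u} ?\<psi> + integral {u..\<epsilon>} ?\<psi> = integral {s..\<epsilon>} ?\<psi>"
    using u int[OF assms(2)] by (intro Henstock_Kurzweil_Integration.integral_combine) auto
  ultimately show ?thesis by simp
qed

lemma dyadic_min_sum_le:
  assumes "0 < \<gamma>"
  shows "(\<Sum>n<N. min (\<phi> (\<epsilon> / 2 ^ Suc n) / (\<epsilon> / 2 ^ Suc n) ^ k)
      (\<gamma> * (\<phi> (\<epsilon> / 2 ^ Suc n) / (\<epsilon> / 2 ^ Suc n) ^ (k + 1)))) \<le> 2 ^ (k + 3) * w \<gamma>"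
proof -
  define r where "r n = \<epsilon> / 2 ^ Suc n" for n
  have r: "0 < r n" for n using eps by (simp add: r_def)
  let ?\<psi> = "\<lambda>t. 2 ^ (k + 2) * min (\<phi> t / t ^ (k + 1)) (\<gamma> * (\<phi> t / t ^ (k + 2)))"
  have "(\<Sum>n<N. min (\<phi> (r n) / r n ^ k) (\<gamma> * (\<phi> (r n) / r n ^ (k + 1)))) \<le> integral {\<epsilon> / 2 ^ N..\<epsilon>} ?\<psi>"
  proof (rule dyadic_sum_le_integral[OF eps])
    show "?\<psi> integrable_on {s..\<epsilon>}" if "0 < s" for s
      using that by (intro integrable_continuous_real continuous_intros continuous_on_subset[OF phi_cont]) auto
    fix n t assume t: "\<epsilon> / 2 ^ Suc n \<le> t" "t \<le> \<epsilon> / 2 ^ n"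
    then have rt: "r n \<le> t" "t \<le> 2 * r n" "0 < t" using r[of n] by (auto simp: r_def)
    have quot: "\<phi> (r n) / r n ^ m \<le> r n * (2 ^ (m + 1) * (\<phi> t / t ^ (m + 1)))" for m
    proof -
      have "\<phi> (r n) / r n ^ m = r n * (2 ^ (m + 1) * (\<phi> (r n) / (2 * r n) ^ (m + 1)))"
        using r[of n] by (simp add: power_mult_distrib)
      also have "\<dots> \<le> r n * (2 ^ (m + 1) * (\<phi> t / t ^ (m + 1)))"
        using rt r[of n] phi_pos[of t]
        by (intro mult_left_mono frac_le power_mono mono_onD[OF phi_mono]) (auto simp del: power_Suc)
      finally show ?thesis .
    qed
    have "min (\<phi> (r n) / r n ^ k) (\<gamma> * (\<phi> (r n) / r n ^ (k + 1)))
        \<le> min (r n * (2 ^ (k + 2) * (\<phi> t / t ^ (k + 1)))) (\<gamma> * (r n * (2 ^ (k + 2) * (\<phi> t / t ^ (k + 2)))))"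
    proof (rule min.mono)
      have "\<phi> (r n) / r n ^ k \<le> r n * (2 ^ (k + 1) * (\<phi> t / t ^ (k + 1)))" by (rule quot)
      also have "\<dots> \<le> r n * (2 ^ (k + 2) * (\<phi> t / t ^ (k + 1)))"
        using r[of n] rt quotient_nonneg[of t "k+1"]
        by (intro mult_left_mono mult_right_mono power_increasing) (auto simp del: power_Suc)
      finally show "\<phi> (r n) / r n ^ k \<le> r n * (2 ^ (k + 2) * (\<phi> t / t ^ (k + 1)))" .
      show "\<gamma> * (\<phi> (r n) / r n ^ (k + 1)) \<le> \<gamma> * (r n * (2 ^ (k + 2) * (\<phi> t / t ^ (k + 2))))"
        using quot[of "k+1"] assms by (intro mult_left_mono) auto
    qed
    also have "\<dots> = r n * ?\<psi> t"
      using r[of n] by (simp add: min_mult_distrib_left algebra_simps del: power_Suc)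
    finally show "min (\<phi> (r n) / r n ^ k) (\<gamma> * (\<phi> (r n) / r n ^ (k + 1))) \<le> \<epsilon> / 2 ^ Suc n * ?\<psi> t"
      by (simp add: r_def)
  qed
  also have "\<dots> \<le> 2 ^ (k + 2) * (2 * w \<gamma>)"
    unfolding integral_mult_right using eps
    by (intro mult_left_mono min_quotient_integral_le assms) (auto simp: field_simps)
  also have "\<dots> = 2 ^ (k + 3) * w \<gamma>" by (simp add: power_add)
  finally show ?thesis by (simp only: r_def)
qed

text \<open>For \<open>\<gamma> \<ge> \<epsilon>\<close> the minimum in the previous lemma is its first argument.\<close>

lemma dyadic_summable: "summable (\<lambda>n. \<phi> (\<epsilon> / 2 ^ Suc n) / (\<epsilon> / 2 ^ Suc n) ^ k)"
proof (rule summableI_nonneg_bounded)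
  fix n show "0 \<le> \<phi> (\<epsilon> / 2 ^ Suc n) / (\<epsilon> / 2 ^ Suc n) ^ k"
    using eps by (intro quotient_nonneg) auto
next
  fix N
  have "min (\<phi> (\<epsilon> / 2 ^ Suc n) / (\<epsilon> / 2 ^ Suc n) ^ k)
      (\<epsilon> * (\<phi> (\<epsilon> / 2 ^ Suc n) / (\<epsilon> / 2 ^ Suc n) ^ (k + 1))) = \<phi> (\<epsilon> / 2 ^ Suc n) / (\<epsilon> / 2 ^ Suc n) ^ k" for n
  proof -
    define r where "r = \<epsilon> / 2 ^ Suc n"
    have r: "0 < r" "r \<le> \<epsilon>" using eps mult_left_mono[OF one_le_power[of 2 "Suc n"], of \<epsilon>]
      by (auto simp: r_def divide_le_eq)
    have "1 * (\<phi> r / r ^ k) \<le> \<epsilon> / r * (\<phi> r / r ^ k)"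
      using r quotient_nonneg[of r k] by (intro mult_right_mono) auto
    then have "min (\<phi> r / r ^ k) (\<epsilon> * (\<phi> r / r ^ (k + 1))) = \<phi> r / r ^ k"
      by (simp add: min_def)
    then show ?thesis unfolding r_def .
  qed
  then show "(\<Sum>n<N. \<phi> (\<epsilon> / 2 ^ Suc n) / (\<epsilon> / 2 ^ Suc n) ^ k) \<le> 2 ^ (k + 3) * w \<epsilon>"
    using dyadic_min_sum_le[OF eps, of N] by simp
qed

end

subsection \<open>Term-by-term differentiation\<close>

lemma summable_iter_cpartial:
  fixes e :: real
  assumes g: "\<And>n. sep_holo_bounded (r n) (M n) (g n)"
    and r: "\<And>n. 0 < r n" "\<And>n. r n \<le> e" and M: "\<And>n. 0 \<le> M n"
    and summ: "summable (\<lambda>n. M n / r n ^ k)" and len: "length is \<le> k"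
  shows "summable (\<lambda>n. Re (iter_cpartial is (g n) (cvec x)))"
    and "\<bar>\<Sum>n. Re (iter_cpartial is (g n) (cvec x))\<bar>
      \<le> (\<Sum>n. ((real k + 2) * (1 + e)) ^ k * (M n / r n ^ k))"
proof -
  have bd: "norm (Re (iter_cpartial is (g n) (cvec x))) \<le> ((real k + 2) * (1 + e)) ^ k * (M n / r n ^ k)" for n
    unfolding real_norm_def by (rule Re_iter_cpartial_bound[OF g r(1) M len _ r(2)]) simp
  have s: "summable (\<lambda>n. ((real k + 2) * (1 + e)) ^ k * (M n / r n ^ k))"
    using summ by (rule summable_mult)
  show "summable (\<lambda>n. Re (iter_cpartial is (g n) (cvec x)))"
    using bd by (intro summable_comparison_test'[OF s]) auto
  show "\<bar>\<Sum>n. Re (iter_cpartial is (g n) (cvec x))\<bar>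
      \<le> (\<Sum>n. ((real k + 2) * (1 + e)) ^ k * (M n / r n ^ k))"
    using norm_suminf_le[OF bd s] by simp
qed

lemma iter_partial_series:
  fixes g :: "nat \<Rightarrow> complex^'n \<Rightarrow> complex" and e :: real
  assumes g: "\<And>n. sep_holo_bounded (r n) (M n) (g n)"
    and r: "\<And>n. 0 < r n" "\<And>n. r n \<le> e" and M: "\<And>n. 0 \<le> M n"
    and summ: "summable (\<lambda>n. M n / r n ^ k)"
    and f: "\<And>x. f x = (\<Sum>n. Re (g n (cvec x)))"
    and len: "length is \<le> k"
  shows "partials_exist is f"
    and "iter_partial is f = (\<lambda>x. \<Sum>n. Re (iter_cpartial is (g n) (cvec x)))"
  using len
proof (induction "is")
  case Nil
  { case 1 show ?case by simp }
  { case 2 show ?case using f by auto }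
next
  case (Cons i "is")
  { fix x :: "real^'n" assume len: "length (i # is) \<le> k"
    let ?u = "\<lambda>n t. Re (iter_cpartial is (g n) (cvec (x + t *\<^sub>R axis i 1)))"
    let ?u' = "\<lambda>n t. Re (iter_cpartial (i # is) (g n) (cvec (x + t *\<^sub>R axis i 1)))"
    have "((\<lambda>t. \<Sum>n. ?u n t) has_real_derivative (\<Sum>n. ?u' n 0)) (at 0)"
    proof (rule has_field_derivative_series')
      show "uniformly_convergent_on UNIV (\<lambda>n t. \<Sum>j<n. ?u' j t)"
      proof (rule Weierstrass_m_test')
        show "norm (?u' n t) \<le> ((real k + 2) * (1 + e)) ^ k * (M n / r n ^ k)" for n t
          unfolding real_norm_def by (rule Re_iter_cpartial_bound[OF g r(1) M len _ r(2)]) simp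
        show "summable (\<lambda>n. ((real k + 2) * (1 + e)) ^ k * (M n / r n ^ k))"
          using summ by (rule summable_mult)
      qed
      show "summable (\<lambda>n. ?u n 0)"
        by (rule summable_iter_cpartial[OF g r M summ]) (use len in auto)
    qed (use iter_cpartial_has_real_derivative[OF g r(1)] in auto)
    then have "((\<lambda>t. iter_partial is f (x + t *\<^sub>R axis i 1)) has_real_derivative
        (\<Sum>n. Re (iter_cpartial (i # is) (g n) (cvec x)))) (at 0)"
      using Cons(2) len by simp }
  note der = this
  { case 1
    then show ?case
      using Cons(1) der by (auto simp: real_differentiable_def) }
  { case 2
    then show ?case
      using DERIV_imp_deriv[OF der] by (auto simp: partial_def) }
qed

lemma iter_cpartial_series_modulus:
  fixes g :: "nat \<Rightarrow> complex^'n \<Rightarrow> complex" and e W :: real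
  assumes g: "\<And>n. sep_holo_bounded (r n) (M n) (g n)"
    and r: "\<And>n. 0 < r n" "\<And>n. r n \<le> e" and M: "\<And>n. 0 \<le> M n"
    and summ: "summable (\<lambda>n. M n / r n ^ k)"
    and len: "length is \<le> k"
    and W: "\<And>N. (\<Sum>n<N. min (M n / r n ^ k) (infnorm (x - y) * (M n / r n ^ (k + 1)))) \<le> W"
  shows "\<bar>(\<Sum>n. Re (iter_cpartial is (g n) (cvec x))) - (\<Sum>n. Re (iter_cpartial is (g n) (cvec y)))\<bar>
    \<le> (2 * ((real k + 2) * (1 + e)) ^ k + real CARD('n) * ((real k + 2) * (1 + e)) ^ (k + 1)) * W"
proof -
  define \<gamma> where "\<gamma> = infnorm (x - y)"
  define P where "P = ((real k + 2) * (1 + e)) ^ k"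
  define Q where "Q = real CARD('n) * ((real k + 2) * (1 + e)) ^ (k + 1)"
  have e: "0 < e" using r[of 0] by simp
  have PQ: "0 \<le> P" "0 \<le> Q" using e by (auto simp: P_def Q_def)
  have \<gamma>: "0 \<le> \<gamma>" by (simp add: \<gamma>_def infnorm_pos_le)
  let ?G = "\<lambda>n x. Re (iter_cpartial is (g n) (cvec x))"
  have bound: "\<bar>?G n x - ?G n y\<bar> \<le> (2 * P + Q) * min (M n / r n ^ k) (\<gamma> * (M n / r n ^ (k + 1)))" for n
  proof -
    have sup: "\<bar>?G n z\<bar> \<le> P * (M n / r n ^ k)" for z
      unfolding P_def by (rule Re_iter_cpartial_bound[OF g r(1) M len _ r(2)]) simp
    have "\<bar>?G n x - ?G n y\<bar> \<le> real CARD('n) * (((real k + 2) * (1 + e)) ^ (k + 1) * (M n / r n ^ (k + 1))) * infnorm (x - y)"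
    proof (rule coordinatewise_lipschitz[OF iter_cpartial_has_real_derivative[OF g r(1)]])
      fix z i
      have "length (i # is) \<le> k + 1" using len by simp
      then show "\<bar>Re (iter_cpartial (i # is) (g n) (cvec z))\<bar> \<le> ((real k + 2) * (1 + e)) ^ (k + 1) * (M n / r n ^ (k + 1))"
        by (rule Re_iter_cpartial_bound[OF g r(1) M _ _ r(2)]) simp
    qed
    then have "\<bar>?G n x - ?G n y\<bar> \<le> Q * (\<gamma> * (M n / r n ^ (k + 1)))"
      by (simp add: Q_def \<gamma>_def mult_ac)
    also have "\<dots> \<le> (2 * P + Q) * (\<gamma> * (M n / r n ^ (k + 1)))"
      using PQ \<gamma> M[of n] r(1)[of n] by (intro mult_right_mono) auto
    finally have 1: "\<bar>?G n x - ?G n y\<bar> \<le> (2 * P + Q) * (\<gamma> * (M n / r n ^ (k + 1)))" .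
    have "\<bar>?G n x - ?G n y\<bar> \<le> 2 * P * (M n / r n ^ k)" using sup[of x] sup[of y] by linarith
    also have "\<dots> \<le> (2 * P + Q) * (M n / r n ^ k)"
      using PQ M[of n] r(1)[of n] by (intro mult_right_mono) auto
    finally show ?thesis using 1 by (simp only: min_def split: if_splits) simp
  qed
  have summable: "summable (\<lambda>n. ?G n z)" for z
    by (rule summable_iter_cpartial[OF g r M summ len])
  then have "(\<lambda>n. ?G n x - ?G n y) sums ((\<Sum>n. ?G n x) - (\<Sum>n. ?G n y))"
    by (intro sums_diff summable_sums)
  then have "(\<lambda>N. \<bar>\<Sum>n<N. ?G n x - ?G n y\<bar>) \<longlonglongrightarrow> \<bar>(\<Sum>n. ?G n x) - (\<Sum>n. ?G n y)\<bar>"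
    unfolding sums_def by (rule tendsto_rabs)
  moreover have "\<bar>\<Sum>n<N. ?G n x - ?G n y\<bar> \<le> (2 * P + Q) * W" for N
  proof -
    have "\<bar>\<Sum>n<N. ?G n x - ?G n y\<bar> \<le> (\<Sum>n<N. \<bar>?G n x - ?G n y\<bar>)" by (rule sum_abs)
    also have "\<dots> \<le> (\<Sum>n<N. (2 * P + Q) * min (M n / r n ^ k) (\<gamma> * (M n / r n ^ (k + 1))))"
      by (intro sum_mono bound)
    also have "\<dots> \<le> (2 * P + Q) * W"
      using W[of N] PQ by (simp only: sum_distrib_left[symmetric] \<gamma>_def) (intro mult_left_mono, auto)
    finally show ?thesis .
  qed
  ultimately show ?thesis
    unfolding P_def[symmetric] Q_def[symmetric] by (intro LIMSEQ_le_const2) auto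
qed

lemma sep_holo_bounded_diff:
  fixes F G :: "complex^'n \<Rightarrow> complex"
  assumes "analytic_on_set F (strip r)" "analytic_on_set G (strip s)" "r \<le> s"
    and "\<forall>z\<in>strip r. cmod (F z - G z) \<le> M"
  shows "sep_holo_bounded r M (\<lambda>z. F z - G z)"
proof -
  obtain U V where U: "strip r \<subseteq> U" "holo_on F U" and V: "strip s \<subseteq> V" "holo_on G V"
    using assms by (auto simp: analytic_on_set_def)
  have *: "z \<in> strip r" "z \<in> strip s" if "z \<in> open_strip r" for z
    using that assms(3) by (auto simp: open_strip_def strip_def)
  show ?thesis
    unfolding sep_holo_bounded_def
  proof (intro ballI conjI allI)
    fix z :: "complex^'n" and i assume z: "z \<in> open_strip r"
    show "cmod (F z - G z) \<le> M" using * z assms(4) by blast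
    show "(\<lambda>t. F (z + t *s axis i 1) - G (z + t *s axis i 1)) field_differentiable at 0"
      using * z U(1) V(1)
      by (intro field_differentiable_diff holo_on_imp_field_differentiable_axis[OF U(2)]
          holo_on_imp_field_differentiable_axis[OF V(2)]) auto
  qed
qed

theorem mainTheorem8:
  fixes \<epsilon> :: real and \<phi> :: "real \<Rightarrow> real" and kstar :: nat
    and F :: "nat \<Rightarrow> complex^'n \<Rightarrow> complex" and f :: "real^'n \<Rightarrow> real"
  assumes eps: "\<epsilon> > 0"
    and phi_nonneg: "\<forall>x\<ge>0. \<phi> x \<ge> 0"
    and phi_mono: "mono_on {0..} \<phi>"
    and phi_cont: "continuous_on {0..} \<phi>"
    and phi0: "\<phi> 0 = 0"
    and int_fin: "(\<lambda>x. \<phi> x / x ^ (kstar + 1)) integrable_on {0<..1}"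
    and int_inf: "\<not> (\<lambda>x. \<phi> x / x ^ (kstar + 2)) integrable_on {0<..1}"
    and F_an: "\<forall>\<nu>. analytic_on_set (F \<nu>) (strip (\<epsilon> / 2 ^ \<nu>))"
    and F_real: "\<forall>\<nu> x. Im (F \<nu> (cvec x)) = 0"
    and F0: "\<forall>z. F 0 z = 0"
    and F_diff: "\<forall>\<nu>\<ge>1. \<forall>z\<in>strip (\<epsilon> / 2 ^ \<nu>).
                   cmod (F \<nu> z - F (\<nu> - 1) z) \<le> \<phi> (\<epsilon> / 2 ^ \<nu>)"
    and f_lim: "\<forall>x. (\<lambda>\<nu>. F \<nu> (cvec x)) \<longlonglongrightarrow> complex_of_real (f x)"
  shows "\<exists>w \<delta> L. modulus_of_continuity w \<delta> \<and> C_kw kstar w \<delta> f \<and>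
           filterlim L (at_right 0) (at_right 0) \<and>
           bigO_sharp w (\<lambda>\<gamma>. \<gamma> * integral {L \<gamma>..\<epsilon>} (\<lambda>t. \<phi> t / t ^ (kstar + 2))) \<and>
           bigO_sharp (\<lambda>\<gamma>. \<gamma> * integral {L \<gamma>..\<epsilon>} (\<lambda>t. \<phi> t / t ^ (kstar + 2)))
                      (\<lambda>\<gamma>. integral {0..L \<gamma>} (\<lambda>t. \<phi> t / t ^ (kstar + 1)))"
proof -
  interpret weight \<epsilon> \<phi> kstar
    using eps phi_nonneg phi_mono phi_cont int_fin int_inf by unfold_locales
  define r where "r n = \<epsilon> / 2 ^ Suc n" for n
  define g where "g n z = F (Suc n) z - F n z" for n z
  have r: "0 < r n" "r n \<le> \<epsilon>" for n
    using eps mult_left_mono[OF one_le_power[of 2 "Suc n"], of \<epsilon>]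
    by (auto simp: r_def divide_le_eq)
  have M: "0 \<le> \<phi> (r n)" for n using phi_nonneg r[of n] by simp
  have g: "sep_holo_bounded (r n) (\<phi> (r n)) (g n)" for n
    unfolding g_def
  proof (rule sep_holo_bounded_diff)
    show "analytic_on_set (F (Suc n)) (strip (r n))" "analytic_on_set (F n) (strip (\<epsilon> / 2 ^ n))"
      using F_an unfolding r_def by blast+
    show "r n \<le> \<epsilon> / 2 ^ n" using eps by (simp add: r_def frac_le)
    show "\<forall>z\<in>strip (r n). cmod (F (Suc n) z - F n z) \<le> \<phi> (r n)"
      using F_diff[rule_format, of "Suc n"] by (simp add: r_def)
  qed
  have summ: "summable (\<lambda>n. \<phi> (r n) / r n ^ kstar)"
    unfolding r_def by (rule dyadic_summable)
  have f: "f x = (\<Sum>n. Re (g n (cvec x)))" for x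
  proof (rule sums_unique)
    have "(\<Sum>n<N. Re (g n (cvec x))) = Re (F N (cvec x))" for N
      using F0 by (induction N) (auto simp: g_def)
    then show "(\<lambda>n. Re (g n (cvec x))) sums f x"
      using tendsto_Re[OF f_lim[rule_format, of x]] by (simp add: sums_def)
  qed
  note series = iter_partial_series[OF g r M summ f]
  have "C_kw kstar w 1 f"
    unfolding C_kw_def
  proof (intro allI impI conjI)
    fix "is" :: "'n list" assume len: "length is \<le> kstar"
    show "partials_exist is f" using series(1)[OF len] .
    show "\<exists>B. \<forall>x. \<bar>iter_partial is f x\<bar> \<le> B"
      using summable_iter_cpartial(2)[OF g r M summ len] unfolding series(2)[OF len] by blast
    let ?C = "2 * ((real kstar + 2) * (1 + \<epsilon>)) ^ kstar + real CARD('n) * ((real kstar + 2) * (1 + \<epsilon>)) ^ (kstar + 1)"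
    have "\<bar>iter_partial is f x - iter_partial is f y\<bar> \<le> ?C * 2 ^ (kstar + 3) * w (infnorm (x - y))"
      if "0 < infnorm (x - y)" for x y
      unfolding series(2)[OF len] mult.assoc[of _ "2 ^ (kstar + 3)"]
      using dyadic_min_sum_le[OF that]
      by (intro iter_cpartial_series_modulus[OF g r M summ len]) (simp add: r_def)
    then show "\<exists>C. \<forall>x y. 0 < infnorm (x - y) \<and> infnorm (x - y) \<le> 1 \<longrightarrow>
        \<bar>iter_partial is f x - iter_partial is f y\<bar> \<le> C * w (infnorm (x - y))"
      by blast
  qed
  moreover have "bigO_sharp w (\<lambda>\<gamma>. \<gamma> * integral {L \<gamma>..\<epsilon>} (\<lambda>t. \<phi> t / t ^ (kstar + 2)))"
    unfolding bigO_sharp_def B_def[symmetric]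
    by (rule exI[of _ 1], rule exI[of _ 1]) (auto intro!: eventually_at_rightI[of 0 1] simp: w_def L)
  moreover have "bigO_sharp (\<lambda>\<gamma>. \<gamma> * integral {L \<gamma>..\<epsilon>} (\<lambda>t. \<phi> t / t ^ (kstar + 2)))
      (\<lambda>\<gamma>. integral {0..L \<gamma>} (\<lambda>t. \<phi> t / t ^ (kstar + 1)))"
    unfolding bigO_sharp_def B_def[symmetric] A_def[symmetric]
    by (rule exI[of _ 1], rule exI[of _ 1]) (auto intro!: eventually_at_rightI[of 0 1] simp: L)
  ultimately show ?thesis
    using w_modulus L_at_right by blast
qed

end
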